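(* For any graph $G$ on $n$ vertices, there is an embedding $\phi\colon \mathcal{F}(G) \to \mathbb{Q}^{2^n-1}$ such that $\phi$ keeps convex structure (i.e. $\phi(\lambda \mathbf{c}_1 + (1-\lambda)\mathbf{c}_2)=\lambda\phi(\mathbf{c}_1)+(1-\lambda)\phi(\mathbf{c}_2)$ for all rational $\lambda\in[0,1]$). Moreover, for any rational number $\tau$, $\mathcal{F}_\tau(G)$ is the convex hull of some extremal fractional colorings.
   Context: Let $G$ be a graph. A $b$-fold coloring $\mathbf{c}$ of $G$ assigns a set of $b$ colors to each vertex so that adjacent vertices receive disjoint sets; $A(\mathbf{c})=\cup_{v\in V(G)}\mathbf{c}(v)$ is the set of colors used. Two $b$-fold colorings are isomorphic if they differ by a bijection of color sets; $\mathcal{C}_b(G)$ is the set of isomorphism classes of $b$-fold colorings and $\mathcal{C}(G)=\cup_{b\ge 0}\mathcal{C}_b(G)$. For $\mathbf{c}_1\in\mathcal{C}_{b_1}(G)$, $\mathbf{c}_2\in\mathcal{C}_{b_2}(G)$, the sum $\mathbf{c}_1+\mathbf{c}_2\in\mathcal{C}_{b_1+b_2}(G)$ assigns to each $v$ the disjoint union $\mathbf{c}_1(v)\sqcup\mathbf{c}_2(v)$, and $t\cdot\mathbf{c}$ is the sum of $t$ copies of $\mathbf{c}$. We write $\mathbf{c}_1\sim\mathbf{c}_2$ if $sb_2\cdot\mathbf{c}_1\cong sb_1\cdot\mathbf{c}_2$ for some positive integer $s$; this is an equivalence relation. The set of fractional colorings is $\mathcal{F}(G)=\mathcal{C}(G)/\sim$,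 and the class of $\mathbf{c}\in\mathcal{C}_b(G)$ is denoted $\frac{\mathbf{c}}{b}$. For rational $\lambda=\frac{q}{p}\in[0,1]$, the convex combination is $\lambda\frac{\mathbf{c}_1}{b_1}+(1-\lambda)\frac{\mathbf{c}_2}{b_2}=\frac{qb_2\cdot\mathbf{c}_1+(p-q)b_1\cdot\mathbf{c}_2}{pb_1b_2}$ (well defined). Define $g_G(\frac{\mathbf{c}}{b})=\frac{|A(\mathbf{c})|}{b}$ and, for $\tau>0$, $\mathcal{F}_\tau(G)=\{\frac{\mathbf{c}}{b}\in\mathcal{F}(G): g_G(\frac{\mathbf{c}}{b})\le\tau\}$. A fractional coloring is extremal in $\mathcal{F}_\tau(G)$ if it cannot be written as a linear (convex) combination of two or more distinct fractional colorings in $\mathcal{F}_\tau(G)$. *)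

theory Defs
  imports "Graph_Theory.Digraph" "Jordan_Normal_Form.Matrix" "HOL-Library.Nat_Bijection"
begin

text \<open>
  A finite simple graph is a symmetric, loop-free finite digraph without multiple arcs (locale
  \<^locale>\<open>graph\<close>).  Only the values of a colouring on the vertices matter.  Using
  natural numbers as colours is no restriction: a \<open>b\<close>-fold colouring of a finite graph
  uses finitely many colours, and colourings are only considered up to isomorphism.
\<close>

type_synonym 'a coloring = "'a \<Rightarrow> nat set"

definition fold_coloring :: "('a, 'b) pre_digraph \<Rightarrow> nat \<Rightarrow> 'a coloring \<Rightarrow> bool" where
  "fold_coloring G b c \<longleftrightarrow>
     (\<forall>v\<in>verts G. finite (c v) \<and> card (c v) = b) \<and>
     (\<forall>u v. u \<rightarrow>\<^bsub>G\<^esub> v \<longrightarrow> c u \<inter> c v = {})"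

definition colors_used :: "('a, 'b) pre_digraph \<Rightarrow> 'a coloring \<Rightarrow> nat set" where
  "colors_used G c = (\<Union>v\<in>verts G. c v)"

definition coloring_iso :: "('a, 'b) pre_digraph \<Rightarrow> 'a coloring \<Rightarrow> 'a coloring \<Rightarrow> bool" where
  "coloring_iso G c1 c2 \<longleftrightarrow>
     (\<exists>f. bij_betw f (colors_used G c1) (colors_used G c2) \<and> (\<forall>v\<in>verts G. c2 v = f ` c1 v))"

text \<open>
  The disjoint union \<open><+>\<close> lives in \<open>nat + nat\<close> and is carried back to
  \<open>nat\<close> along the bijection \<^const>\<open>sum_encode\<close>.
\<close>

definition coloring_sum :: "'a coloring \<Rightarrow> 'a coloring \<Rightarrow> 'a coloring" where
  "coloring_sum c1 c2 = (\<lambda>v. sum_encode ` (c1 v <+> c2 v))"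

primrec coloring_mult :: "nat \<Rightarrow> 'a coloring \<Rightarrow> 'a coloring" where
  "coloring_mult 0 c = (\<lambda>v. {})"
| "coloring_mult (Suc t) c = coloring_sum c (coloring_mult t c)"

text \<open>
  Colourings are paired with their fold number \<open>b\<close>, which must be positive: the empty
  0-fold colouring would be related to every colouring, and \<open>~\<close> would not be transitive.
  Isomorphic \<open>b\<close>-fold colourings are related (take \<open>s = 1\<close>), so the quotient of
  concrete colourings is the quotient of isomorphism classes of colourings.
\<close>

definition fold_colorings :: "('a, 'b) pre_digraph \<Rightarrow> (nat \<times> 'a coloring) set" where
  "fold_colorings G = {(b, c). 0 < b \<and> fold_coloring G b c}"

definition frac_rel ::
    "('a, 'b) pre_digraph \<Rightarrow> ((nat \<times> 'a coloring) \<times> (nat \<times> 'a coloring)) set" where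
  "frac_rel G = {((b1, c1), (b2, c2)).
     (b1, c1) \<in> fold_colorings G \<and> (b2, c2) \<in> fold_colorings G \<and>
     (\<exists>s>0. coloring_iso G (coloring_mult (s * b2) c1) (coloring_mult (s * b1) c2))}"

type_synonym 'a frac_coloring = "(nat \<times> 'a coloring) set"

definition frac_colorings :: "('a, 'b) pre_digraph \<Rightarrow> 'a frac_coloring set" where
  "frac_colorings G = fold_colorings G // frac_rel G"

definition frac_class :: "('a, 'b) pre_digraph \<Rightarrow> nat \<Rightarrow> 'a coloring \<Rightarrow> 'a frac_coloring" where
  "frac_class G b c = frac_rel G `` {(b, c)}"

text \<open>
  The convex combination \<open>l X + (1 - l) Y\<close>.  The class on the right does not depend on the
  representatives of \<open>X\<close> and \<open>Y\<close> nor on the fraction \<open>q / p\<close> for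
  \<open>l\<close>, so the union over all choices is that class.
\<close>

definition frac_mix ::
    "('a, 'b) pre_digraph \<Rightarrow> rat \<Rightarrow> 'a frac_coloring \<Rightarrow> 'a frac_coloring \<Rightarrow> 'a frac_coloring" where
  "frac_mix G l X Y = \<Union> {frac_class G (p * b1 * b2)
        (coloring_sum (coloring_mult (q * b2) c1) (coloring_mult ((p - q) * b1) c2)) |
      q p b1 c1 b2 c2.
        0 < p \<and> q \<le> p \<and> l = of_nat q / of_nat p \<and> (b1, c1) \<in> X \<and> (b2, c2) \<in> Y}"

text \<open>
  The convex combination of finitely many classes, with positive weights of sum 1, by iterating
  the binary one; in the recursive calls the weights are implicitly normalised to sum 1.
\<close>

fun frac_comb ::
    "('a, 'b) pre_digraph \<Rightarrow> (rat \<times> 'a frac_coloring) list \<Rightarrow> 'a frac_coloring" where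
  "frac_comb G [] = {}"
| "frac_comb G [(w, X)] = X"
| "frac_comb G ((w, X) # y # ys) =
     frac_mix G (w / (w + sum_list (map fst (y # ys)))) X (frac_comb G (y # ys))"

text \<open>All representatives of a class give the same value, so the image is a singleton.\<close>

definition frac_weight :: "('a, 'b) pre_digraph \<Rightarrow> 'a frac_coloring \<Rightarrow> rat" where
  "frac_weight G X = the_elem ((\<lambda>(b, c). of_nat (card (colors_used G c)) / of_nat b) ` X)"

definition frac_colorings_le :: "('a, 'b) pre_digraph \<Rightarrow> rat \<Rightarrow> 'a frac_coloring set" where
  "frac_colorings_le G \<tau> = {X \<in> frac_colorings G. frac_weight G X \<le> \<tau>}"

definition frac_extremal ::
    "('a, 'b) pre_digraph \<Rightarrow> 'a frac_coloring set \<Rightarrow> 'a frac_coloring \<Rightarrow> bool" where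
  "frac_extremal G T X \<longleftrightarrow> X \<in> T \<and>
     (\<nexists>ws. 2 \<le> length ws \<and> distinct (map snd ws) \<and> snd ` set ws \<subseteq> T \<and>
        (\<forall>w\<in>fst ` set ws. 0 < w) \<and> sum_list (map fst ws) = 1 \<and> X = frac_comb G ws)"

definition frac_convex :: "('a, 'b) pre_digraph \<Rightarrow> 'a frac_coloring set \<Rightarrow> bool" where
  "frac_convex G T \<longleftrightarrow> T \<subseteq> frac_colorings G \<and>
     (\<forall>X\<in>T. \<forall>Y\<in>T. \<forall>l. 0 \<le> l \<and> l \<le> 1 \<longrightarrow> frac_mix G l X Y \<in> T)"

end

theory Submission
  imports Defs
begin

text \<open>
  Up to isomorphism a coloring is determined by how many of its colors occur on exactly the vertex
  set \<open>S\<close>, for each nonempty \<open>S\<close>.  Dividing these counts by the fold number embeds the fractional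
  colorings, affinely and onto the rational points of a polytope: the nonnegative functions
  supported on independent sets whose sum over the sets containing any given vertex is 1.
  A point of this polytope that is not extremal can be moved both ways along the difference of two
  points that occur in a convex combination for it, until a further coordinate vanishes; induction
  on the support then writes it as a convex combination of extremal points.
\<close>

definition color_count :: "('a, 'b) pre_digraph \<Rightarrow> 'a coloring \<Rightarrow> 'a set \<Rightarrow> nat" where
  "color_count G c S = card {x \<in> colors_used G c. {v \<in> verts G. x \<in> c v} = S}"

text \<open>All representatives of a class have the same quotient at \<open>S\<close>, so the image
  is a singleton; \<open>frac_profile_eq\<close> evaluates it.\<close>

definition frac_profile :: "('a, 'b) pre_digraph \<Rightarrow> 'a frac_coloring \<Rightarrow> 'a set \<Rightarrow> rat" where
  "frac_profile G X S = the_elem ((\<lambda>(b, c). of_nat (color_count G c S) / of_nat b) ` X)"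

text \<open>These are the weightings of independent sets that cover every vertex with total weight
  exactly 1. Values off the nonempty subsets of \<open>verts G\<close> are forced to be 0, so for
  finite \<open>verts G\<close> finitely many coordinates determine the function.\<close>

definition feasible_profile :: "('a, 'b) pre_digraph \<Rightarrow> ('a set \<Rightarrow> rat) \<Rightarrow> bool" where
  "feasible_profile G x \<longleftrightarrow>
     (\<forall>S. 0 \<le> x S) \<and>
     (\<forall>S. x S \<noteq> 0 \<longrightarrow> S \<noteq> {} \<and> S \<subseteq> verts G \<and> (\<forall>u\<in>S. \<forall>v\<in>S. \<not> u \<rightarrow>\<^bsub>G\<^esub> v)) \<and>
     (\<forall>v\<in>verts G. (\<Sum>S | S \<subseteq> verts G \<and> v \<in> S. x S) = 1)"

text \<open>
  The empty set carries no color, so its coordinate is free to hold the slack of the constraint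
  that the weight is at most \<open>\<tau>\<close>.
\<close>

definition slack_profile ::
    "('a, 'b) pre_digraph \<Rightarrow> rat \<Rightarrow> 'a frac_coloring \<Rightarrow> 'a set \<Rightarrow> rat" where
  "slack_profile G \<tau> X S = (if S = {} then \<tau> - frac_weight G X else frac_profile G X S)"

section \<open>Nonnegative rational vectors\<close>

text \<open>Clearing denominators is what turns a rational point into numbers of colors. The
  induction multiplies the denominator found so far by that of the new entry.\<close>

lemma common_denominator:
  fixes x :: "'i \<Rightarrow> rat"
  assumes "finite I" "\<And>i. i \<in> I \<Longrightarrow> 0 \<le> x i"
  obtains b N where "0 < b" "\<And>i. i \<in> I \<Longrightarrow> x i = of_nat (N i) / of_nat b"
proof -
  have "\<exists>b>0. \<forall>i\<in>I. \<exists>m. x i = of_nat m / of_nat b"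
    using assms
  proof (induction I rule: finite_induct)
    case empty
    show ?case by (auto intro: exI[of _ 1])
  next
    case (insert i I)
    then obtain b where b: "0 < b" "\<forall>j\<in>I. \<exists>m. x j = of_nat m / of_nat b" by auto
    obtain a d where ad: "quotient_of (x i) = (a, d)" by fastforce
    have d: "0 < d" and xa: "x i = of_int a / of_int d"
      using quotient_of_denom_pos[OF ad] quotient_of_div[OF ad] by auto
    have a: "0 \<le> a" using insert.prems[of i] d unfolding xa by (auto simp: zero_le_divide_iff)
    have "x i = of_nat (nat a * b) / of_nat (b * nat d)"
      using a d b(1) xa by simp
    moreover have "\<exists>m. x j = of_nat m / of_nat (b * nat d)" if j: "j \<in> I" for j
    proof -
      obtain m where "x j = of_nat m / of_nat b" using b(2) j by blast
      then have "x j = of_nat (m * nat d) / of_nat (b * nat d)" using d by simp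
      then show ?thesis by blast
    qed
    ultimately have "\<forall>j\<in>insert i I. \<exists>m. x j = of_nat m / of_nat (b * nat d)" by blast
    moreover have "0 < b * nat d" using b(1) d by simp
    ultimately show ?case by blast
  qed
  then show thesis using that by metis
qed

text \<open>This is the ratio test of the simplex method: \<open>t\<close> is the least quotient
  \<open>x i / - d i\<close> over the decreasing coordinates, and \<open>i\<close> attains it. A
  coordinate where \<open>x\<close> vanishes does not move, so all these quotients are
  positive.\<close>

lemma ratio_test:
  fixes x d :: "'i \<Rightarrow> rat"
  assumes "finite I" "\<forall>i\<in>I. 0 \<le> x i" "\<forall>i\<in>I. x i = 0 \<longrightarrow> d i = 0"
    and "j \<in> I" "d j < 0"
  obtains t i where "0 < t" "\<forall>i\<in>I. 0 \<le> x i + t * d i"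
    "i \<in> I" "x i \<noteq> 0" "x i + t * d i = 0"
proof -
  define R where "R = (\<lambda>i. x i / - d i) ` {i \<in> I. d i < 0}"
  have R: "finite R" "R \<noteq> {}" using assms by (auto simp: R_def)
  obtain i where i: "i \<in> I" "d i < 0" "Min R = x i / - d i"
    using Min_in[OF R] by (auto simp: R_def)
  have xi: "0 < x i" using assms(2,3) i by (metis less_irrefl order_le_less)
  show thesis
  proof (rule that[of "Min R" i])
    show pos: "0 < Min R" using i xi by (simp add: divide_pos_neg)
    show "i \<in> I" "x i \<noteq> 0" "x i + Min R * d i = 0" using i xi by auto
    show "\<forall>k\<in>I. 0 \<le> x k + Min R * d k"
    proof
      fix k assume k: "k \<in> I"
      show "0 \<le> x k + Min R * d k"
      proof (cases "d k < 0")
        case True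
        then have "Min R \<le> x k / - d k" using R k by (auto simp: R_def intro!: Min_le)
        then have "Min R * - d k \<le> x k" using True by (subst (asm) pos_le_divide_eq) auto
        then show ?thesis by simp
      next
        case False
        then show ?thesis using assms(2) k pos by simp
      qed
    qed
  qed
qed

section \<open>Color counts\<close>

lemma fold_coloring_sum:
  assumes "fold_coloring G b1 c1" "fold_coloring G b2 c2"
  shows "fold_coloring G (b1 + b2) (coloring_sum c1 c2)"
  using assms unfolding fold_coloring_def coloring_sum_def
  by (auto simp: card_image inj_sum_encode card_Plus inj_eq) blast+

lemma fold_coloring_mult:
  assumes "fold_coloring G b c"
  shows "fold_coloring G (t * b) (coloring_mult t c)"
proof (induction t)
  case 0
  show ?case by (simp add: fold_coloring_def)
next
  case (Suc t)
  then show ?case using fold_coloring_sum[OF assms Suc] by simp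
qed

text \<open>A used color occurs at some vertex. This is why \<open>slack_profile\<close> can give
  the coordinate at \<open>{}\<close> another meaning.\<close>

lemma color_count_empty [simp]: "color_count G c {} = 0"
proof -
  have "{x \<in> colors_used G c. {v \<in> verts G. x \<in> c v} = {}} = {}"
    by (auto simp: colors_used_def)
  then show ?thesis unfolding color_count_def by (simp only: card.empty)
qed

lemma color_count_eq_0: "\<not> S \<subseteq> verts G \<Longrightarrow> color_count G c S = 0"
  unfolding color_count_def by (auto simp: card_eq_0_iff)

text \<open>A color of the sum comes from exactly one summand, and tagging it does not change the
  set of vertices that carry it.\<close>

lemma color_count_sum:
  assumes "finite (colors_used G c1)" "finite (colors_used G c2)"
  shows "color_count G (coloring_sum c1 c2) S = color_count G c1 S + color_count G c2 S"
proof -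
  let ?A = "\<lambda>c. {x \<in> colors_used G c. {v \<in> verts G. x \<in> c v} = S}"
  have L: "sum_encode (Inl x) \<in> coloring_sum c1 c2 v \<longleftrightarrow> x \<in> c1 v"
    and R: "sum_encode (Inr x) \<in> coloring_sum c1 c2 v \<longleftrightarrow> x \<in> c2 v" for x v
    by (auto simp: coloring_sum_def inj_image_mem_iff[OF inj_sum_encode])
  have "?A (coloring_sum c1 c2) = sum_encode ` (?A c1 <+> ?A c2)"
  proof (rule Set.set_eqI)
    fix y
    obtain z where y: "y = sum_encode z" by (metis sum_decode_inverse)
    show "y \<in> ?A (coloring_sum c1 c2) \<longleftrightarrow> y \<in> sum_encode ` (?A c1 <+> ?A c2)"
      unfolding y inj_image_mem_iff[OF inj_sum_encode]
      by (cases z) (auto simp: L R colors_used_def)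
  qed
  then show ?thesis using assms
    by (simp add: color_count_def card_image inj_sum_encode card_Plus)
qed

text \<open>An isomorphism preserves the set of vertices carrying a color, so it restricts to a
  bijection between the colors counted at \<open>S\<close> on the two sides.\<close>

lemma coloring_iso_color_count:
  assumes "coloring_iso G c1 c2"
  shows "color_count G c1 S = color_count G c2 S"
proof -
  obtain f where f: "bij_betw f (colors_used G c1) (colors_used G c2)"
    and c2: "\<And>v. v \<in> verts G \<Longrightarrow> c2 v = f ` c1 v"
    using assms by (auto simp: coloring_iso_def)
  have inj: "inj_on f (colors_used G c1)" using f by (simp add: bij_betw_def)
  have mem: "f x \<in> c2 v \<longleftrightarrow> x \<in> c1 v" if "x \<in> colors_used G c1" "v \<in> verts G" for x v
  proof -
    have "c1 v \<subseteq> colors_used G c1" using that by (auto simp: colors_used_def)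
    then show ?thesis using inj_on_image_mem_iff[OF inj that(1)] c2[OF that(2)] by simp
  qed
  have pat: "{v \<in> verts G. f x \<in> c2 v} = {v \<in> verts G. x \<in> c1 v}"
    if "x \<in> colors_used G c1" for x
    using mem[OF that] by auto
  have "f ` {x \<in> colors_used G c1. {v \<in> verts G. x \<in> c1 v} = S} =
      {y \<in> f ` colors_used G c1. {v \<in> verts G. y \<in> c2 v} = S}"
    using pat by blast
  then have img: "f ` {x \<in> colors_used G c1. {v \<in> verts G. x \<in> c1 v} = S} =
      {x \<in> colors_used G c2. {v \<in> verts G. x \<in> c2 v} = S}"
    using f by (simp only: bij_betw_def)
  have "inj_on f {x \<in> colors_used G c1. {v \<in> verts G. x \<in> c1 v} = S}"
    by (rule inj_on_subset[OF inj]) auto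
  then show ?thesis
    unfolding color_count_def img[symmetric] by (rule card_image[symmetric])
qed

text \<open>For the converse, equal finite counts give, for each vertex set, a bijection between the
  colors with that vertex set; these bijections glue to an isomorphism.\<close>

lemma coloring_iso_iff:
  assumes fin: "finite (colors_used G c1)" "finite (colors_used G c2)"
  shows "coloring_iso G c1 c2 \<longleftrightarrow> (\<forall>S. color_count G c1 S = color_count G c2 S)"
proof
  assume "coloring_iso G c1 c2"
  then show "\<forall>S. color_count G c1 S = color_count G c2 S"
    using coloring_iso_color_count by blast
next
  assume eq: "\<forall>S. color_count G c1 S = color_count G c2 S"
  define P where "P c x = {v \<in> verts G. x \<in> c v}" for c :: "'a coloring" and x
  define A where "A c S = {x \<in> colors_used G c. P c x = S}" for c S
  have P: "v \<in> P c x \<longleftrightarrow> x \<in> c v" if "v \<in> verts G" for v c x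
    using that by (simp add: P_def)
  have A: "x \<in> A c S \<longleftrightarrow> x \<in> colors_used G c \<and> P c x = S" for x c S
    by (simp add: A_def)
  have "\<forall>S. \<exists>g. bij_betw g (A c1 S) (A c2 S)"
    using fin eq
    by (intro allI finite_same_card_bij) (simp_all add: A_def P_def color_count_def)
  from choice[OF this] obtain g where g: "bij_betw (g S) (A c1 S) (A c2 S)" for S
    by blast
  \<comment> \<open>Each color is mapped by the bijection that belongs to its own vertex set. The
    image has the same vertex set, so the pieces cannot collide.\<close>
  define f where "f x = g (P c1 x) x" for x
  have f: "f x \<in> colors_used G c2" "P c2 (f x) = P c1 x" if "x \<in> colors_used G c1" for x
    using bij_betw_apply[OF g, of x "P c1 x"] that by (auto simp: f_def A)
  have inj: "inj_on f (colors_used G c1)"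
  proof (rule inj_onI)
    fix x y
    assume xy: "x \<in> colors_used G c1" "y \<in> colors_used G c1" "f x = f y"
    then have p: "P c1 x = P c1 y" using f(2) by metis
    then have "g (P c1 y) x = g (P c1 y) y" using xy(3) by (simp add: f_def)
    moreover have "x \<in> A c1 (P c1 y)" "y \<in> A c1 (P c1 y)" using xy p by (auto simp: A)
    ultimately show "x = y"
      using bij_betw_imp_inj_on[OF g[of "P c1 y"]] by (meson inj_onD)
  qed
  have pre: "\<exists>x \<in> colors_used G c1. f x = y" if "y \<in> colors_used G c2" for y
  proof -
    have "y \<in> g (P c2 y) ` A c1 (P c2 y)"
      using bij_betw_imp_surj_on[OF g[of "P c2 y"]] that by (simp add: A)
    then obtain x where "y = g (P c2 y) x" "x \<in> A c1 (P c2 y)" by (rule imageE)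
    then show ?thesis by (intro bexI[of _ x]) (auto simp: f_def A)
  qed
  have "c2 v = f ` c1 v" if v: "v \<in> verts G" for v
  proof (rule Set.set_eqI)
    fix y
    show "y \<in> c2 v \<longleftrightarrow> y \<in> f ` c1 v"
    proof
      assume y: "y \<in> c2 v"
      then obtain x where x: "x \<in> colors_used G c1" "f x = y"
        using pre[of y] v by (auto simp: colors_used_def)
      then show "y \<in> f ` c1 v" using f(2)[OF x(1)] v x y P by blast
    next
      assume "y \<in> f ` c1 v"
      then obtain x where x: "x \<in> c1 v" "y = f x" by blast
      then have "x \<in> colors_used G c1" using v by (auto simp: colors_used_def)
      then show "y \<in> c2 v" using f(2)[of x] v x P by blast
    qed
  qed
  moreover have "bij_betw f (colors_used G c1) (colors_used G c2)"
    using inj f(1) pre by (auto simp: bij_betw_def)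
  ultimately show "coloring_iso G c1 c2" by (auto simp: coloring_iso_def)
qed

section \<open>Profiles of fractional colorings\<close>

lemma feasible_profile_support:
  "feasible_profile G x \<Longrightarrow> x S \<noteq> 0 \<Longrightarrow> S \<noteq> {} \<and> S \<subseteq> verts G"
  by (simp add: feasible_profile_def)

lemma feasible_profile_empty: "feasible_profile G x \<Longrightarrow> x {} = 0"
  using feasible_profile_support by blast

context
  fixes G :: "('a, 'b) pre_digraph"
  assumes fin: "finite (verts G)"
begin

section \<open>Color counts over a finite vertex set\<close>

lemma finite_colors_used: "fold_coloring G b c \<Longrightarrow> finite (colors_used G c)"
  using fin by (simp add: fold_coloring_def colors_used_def)

lemma color_count_mult:
  assumes "fold_coloring G b c"
  shows "color_count G (coloring_mult t c) S = t * color_count G c S"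
proof (induction t)
  case 0
  have "colors_used G (\<lambda>v. {}) = {}" by (simp add: colors_used_def)
  then show ?case by (simp add: color_count_def)
next
  case (Suc t)
  then show ?case
    using color_count_sum[OF finite_colors_used[OF assms]
        finite_colors_used[OF fold_coloring_mult[OF assms]]] by simp
qed

text \<open>Sorting the \<open>b\<close> colors at \<open>v\<close> by the set of vertices carrying
  them gives one block for each \<open>S\<close> that contains \<open>v\<close>, and the blocks are
  disjoint.\<close>

lemma card_fold_eq_sum_color_count:
  assumes c: "fold_coloring G b c" and v: "v \<in> verts G"
  shows "b = (\<Sum>S | S \<subseteq> verts G \<and> v \<in> S. color_count G c S)"
proof -
  define P where "P x = {v \<in> verts G. x \<in> c v}" for x
  define A where "A S = {x \<in> colors_used G c. P x = S}" for S
  have P: "P x \<subseteq> verts G" "v \<in> P x \<longleftrightarrow> x \<in> c v" for x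
    using v by (auto simp: P_def)
  have "c v \<subseteq> colors_used G c" using v by (auto simp: colors_used_def)
  then have "c v = (\<Union>S\<in>{S. S \<subseteq> verts G \<and> v \<in> S}. A S)"
    using P by (auto simp: A_def)
  moreover have "card \<dots> = (\<Sum>S | S \<subseteq> verts G \<and> v \<in> S. card (A S))"
    using fin finite_colors_used[OF c] by (intro card_UN_disjoint) (auto simp: A_def)
  moreover have "card (A S) = color_count G c S" for S
    by (simp add: A_def P_def color_count_def)
  moreover have "card (c v) = b" using c v by (simp add: fold_coloring_def)
  ultimately show ?thesis by simp
qed

lemma card_colors_used:
  assumes c: "fold_coloring G b c"
  shows "card (colors_used G c) = (\<Sum>S\<in>Pow (verts G). color_count G c S)"
proof -
  define P where "P x = {v \<in> verts G. x \<in> c v}" for x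
  define A where "A S = {x \<in> colors_used G c. P x = S}" for S
  have "P x \<subseteq> verts G" for x by (auto simp: P_def)
  then have "colors_used G c = (\<Union>S\<in>Pow (verts G). A S)"
    by (auto simp: A_def)
  moreover have "card \<dots> = (\<Sum>S\<in>Pow (verts G). card (A S))"
    using fin finite_colors_used[OF c] by (intro card_UN_disjoint) (auto simp: A_def)
  moreover have "card (A S) = color_count G c S" for S
    by (simp add: A_def P_def color_count_def)
  ultimately show ?thesis by simp
qed

lemma color_count_independent:
  assumes c: "fold_coloring G b c" and "color_count G c S \<noteq> 0" "u \<in> S" "v \<in> S"
  shows "\<not> u \<rightarrow>\<^bsub>G\<^esub> v"
proof -
  obtain x where "{v \<in> verts G. x \<in> c v} = S"
    using assms(2) unfolding color_count_def by (auto simp: card_eq_0_iff)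
  then have "x \<in> c u \<inter> c v" using assms by auto
  then show ?thesis using c by (auto simp: fold_coloring_def)
qed

text \<open>Multiples scale the color counts, so by \<open>coloring_iso_iff\<close> the factor
  \<open>s\<close> cancels and the cross-multiplied equality of counts remains.\<close>

lemma frac_rel_iff:
  "((b1, c1), (b2, c2)) \<in> frac_rel G \<longleftrightarrow>
     (b1, c1) \<in> fold_colorings G \<and> (b2, c2) \<in> fold_colorings G \<and>
     (\<forall>S. (of_nat (color_count G c1 S) / of_nat b1 :: rat) =
        of_nat (color_count G c2 S) / of_nat b2)"
proof (cases "(b1, c1) \<in> fold_colorings G \<and> (b2, c2) \<in> fold_colorings G")
  case True
  then have b: "0 < b1" "0 < b2" and c: "fold_coloring G b1 c1" "fold_coloring G b2 c2"
    by (auto simp: fold_colorings_def)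
  have "coloring_iso G (coloring_mult (s * b2) c1) (coloring_mult (s * b1) c2) \<longleftrightarrow>
      (\<forall>S. color_count G c1 S * b2 = color_count G c2 S * b1)" if "0 < s" for s
    using that
    by (subst coloring_iso_iff)
      (auto intro: finite_colors_used fold_coloring_mult[OF c(1)] fold_coloring_mult[OF c(2)]
        simp: color_count_mult[OF c(1)] color_count_mult[OF c(2)] ac_simps)
  moreover have "(of_nat (color_count G c1 S) / of_nat b1 :: rat) =
        of_nat (color_count G c2 S) / of_nat b2 \<longleftrightarrow>
      color_count G c1 S * b2 = color_count G c2 S * b1" for S
    using b by (simp add: frac_eq_eq flip: of_nat_mult)
  ultimately show ?thesis
    using True by (auto simp: frac_rel_def)
next
  case False
  then show ?thesis by (auto simp: frac_rel_def)
qed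

text \<open>By \<open>frac_rel_iff\<close> the relation is the kernel of the map \<open>h\<close> on
  \<open>fold_colorings G\<close>; transitivity then involves no multipliers
  \<open>s\<close>.\<close>

lemma equiv_frac_rel: "equiv (fold_colorings G) (frac_rel G)"
proof -
  define h where "h = (\<lambda>(b, c) S. rat_of_nat (color_count G c S) / of_nat b)"
  have "(x, y) \<in> frac_rel G \<longleftrightarrow> x \<in> fold_colorings G \<and> y \<in> fold_colorings G \<and> h x = h y" for x y
    by (cases x; cases y) (simp add: frac_rel_iff h_def fun_eq_iff)
  then show ?thesis
    by (intro equivI refl_onI symI transI subsetI) auto
qed

section \<open>Classes, their representatives and their profiles\<close>

lemma frac_colorings_cases:
  assumes "X \<in> frac_colorings G"
  obtains b c where "(b, c) \<in> X" "0 < b" "fold_coloring G b c" "X = frac_class G b c"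
proof -
  obtain x where x: "x \<in> fold_colorings G" "X = frac_rel G `` {x}"
    using assms unfolding frac_colorings_def by (rule quotientE)
  obtain b c where bc: "x = (b, c)" by (rule prod.exhaust)
  show thesis
  proof (rule that)
    show "(b, c) \<in> X" using equiv_class_self[OF equiv_frac_rel x(1)] x(2) bc by simp
    show "0 < b" "fold_coloring G b c" using x(1) bc by (auto simp: fold_colorings_def)
    show "X = frac_class G b c" using x(2) bc by (simp add: frac_class_def)
  qed
qed

lemma frac_coloringsD:
  assumes "X \<in> frac_colorings G" "(b, c) \<in> X"
  shows "0 < b" "fold_coloring G b c" "X = frac_class G b c"
proof -
  obtain b0 c0 where X: "X = frac_class G b0 c0" using assms(1) by (rule frac_colorings_cases)
  then have r: "((b0, c0), (b, c)) \<in> frac_rel G" using assms(2) by (simp add: frac_class_def)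
  then show "0 < b" "fold_coloring G b c" by (auto simp: frac_rel_iff fold_colorings_def)
  show "X = frac_class G b c"
    unfolding X frac_class_def using equiv_frac_rel r by (rule equiv_class_eq)
qed

lemma frac_class_in_frac_colorings:
  assumes "0 < b" "fold_coloring G b c"
  shows "frac_class G b c \<in> frac_colorings G" "(b, c) \<in> frac_class G b c"
proof -
  have bc: "(b, c) \<in> fold_colorings G" using assms by (simp add: fold_colorings_def)
  show "frac_class G b c \<in> frac_colorings G"
    unfolding frac_colorings_def frac_class_def using bc by (rule quotientI)
  show "(b, c) \<in> frac_class G b c"
    unfolding frac_class_def using equiv_frac_rel bc by (rule equiv_class_self)
qed

lemma frac_profile_eq:
  assumes X: "X \<in> frac_colorings G" and bc: "(b, c) \<in> X"
  shows "frac_profile G X S = of_nat (color_count G c S) / of_nat b"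
proof -
  let ?f = "\<lambda>(b, c). rat_of_nat (color_count G c S) / of_nat b"
  have "?f y = ?f (b, c)" if "y \<in> X" for y
  proof -
    obtain b' c' where y: "y = (b', c')" by (rule prod.exhaust)
    then have "((b, c), (b', c')) \<in> frac_rel G"
      using frac_coloringsD(3)[OF X bc] that by (simp add: frac_class_def)
    then show ?thesis unfolding y frac_rel_iff by simp
  qed
  then have "the_elem (?f ` X) = ?f (b, c)"
    using bc by (intro the_elem_image_unique) auto
  then show ?thesis by (simp add: frac_profile_def)
qed

text \<open>This is injectivity of the profile map, through which equalities between classes are
  proved from now on.\<close>

lemma frac_profile_eqI:
  assumes X: "X \<in> frac_colorings G" and Y: "Y \<in> frac_colorings G"
    and eq: "\<And>S. frac_profile G X S = frac_profile G Y S"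
  shows "X = Y"
proof -
  obtain b1 c1 where 1: "(b1, c1) \<in> X" "0 < b1" "fold_coloring G b1 c1" "X = frac_class G b1 c1"
    using X by (rule frac_colorings_cases)
  obtain b2 c2 where 2: "(b2, c2) \<in> Y" "0 < b2" "fold_coloring G b2 c2" "Y = frac_class G b2 c2"
    using Y by (rule frac_colorings_cases)
  have r: "((b1, c1), (b2, c2)) \<in> frac_rel G"
    using 1(2,3) 2(2,3) eq[unfolded frac_profile_eq[OF X 1(1)] frac_profile_eq[OF Y 2(1)]]
    by (simp add: frac_rel_iff fold_colorings_def)
  show ?thesis
    unfolding 1(4) 2(4) frac_class_def using equiv_frac_rel r by (rule equiv_class_eq)
qed

text \<open>Every used color is counted at exactly one \<open>S\<close>. The bound by \<tau> thereby
  becomes a linear inequality in the profile.\<close>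

lemma frac_weight_eq:
  assumes X: "X \<in> frac_colorings G"
  shows "frac_weight G X = (\<Sum>S\<in>Pow (verts G). frac_profile G X S)"
proof -
  have w: "of_nat (card (colors_used G c)) / of_nat b = (\<Sum>S\<in>Pow (verts G). frac_profile G X S)"
    if "(b, c) \<in> X" for b c
    by (simp add: frac_profile_eq[OF X that] card_colors_used[OF frac_coloringsD(2)[OF X that]]
        sum_divide_distrib)
  obtain b c where bc: "(b, c) \<in> X" using X by (rule frac_colorings_cases)
  let ?f = "\<lambda>(b, c). rat_of_nat (card (colors_used G c)) / of_nat b"
  have "the_elem (?f ` X) = ?f (b, c)"
    using bc w by (intro the_elem_image_unique) auto
  then show ?thesis using w[OF bc] by (simp add: frac_weight_def)
qed

lemma feasible_frac_profile:
  assumes X: "X \<in> frac_colorings G"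
  shows "feasible_profile G (frac_profile G X)"
proof -
  obtain b c where bc: "(b, c) \<in> X" "0 < b" "fold_coloring G b c"
    using X by (rule frac_colorings_cases)
  have "(\<Sum>S | S \<subseteq> verts G \<and> v \<in> S. frac_profile G X S) = 1" if v: "v \<in> verts G" for v
  proof -
    have "(\<Sum>S | S \<subseteq> verts G \<and> v \<in> S. frac_profile G X S) =
        of_nat (\<Sum>S | S \<subseteq> verts G \<and> v \<in> S. color_count G c S) / of_nat b"
      by (simp add: frac_profile_eq[OF X bc(1)] sum_divide_distrib)
    then show ?thesis
      using bc(2) by (simp add: card_fold_eq_sum_color_count[OF bc(3) v, symmetric] del: of_nat_sum)
  qed
  moreover have "S \<noteq> {} \<and> S \<subseteq> verts G \<and> (\<forall>u\<in>S. \<forall>v\<in>S. \<not> u \<rightarrow>\<^bsub>G\<^esub> v)"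
    if "frac_profile G X S \<noteq> 0" for S
  proof -
    have "color_count G c S \<noteq> 0" using that by (auto simp: frac_profile_eq[OF X bc(1)])
    then show ?thesis
      using color_count_independent[OF bc(3)] color_count_eq_0[of S G c] color_count_empty[of G c]
      by metis
  qed
  moreover have "0 \<le> frac_profile G X S" for S by (simp add: frac_profile_eq[OF X bc(1)])
  ultimately show ?thesis
    unfolding feasible_profile_def by blast
qed

text \<open>For every choice of \<open>q\<close>, \<open>p\<close> and representatives, the class in
  the definition of \<open>frac_mix\<close> has the profile \<open>?h\<close>. By injectivity of the
  profile all choices give one class, so the union is that class.\<close>

lemma frac_mix_profile:
  assumes X: "X \<in> frac_colorings G" and Y: "Y \<in> frac_colorings G" and l: "0 \<le> l" "l \<le> 1"
  shows "frac_mix G l X Y \<in> frac_colorings G"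
    and "frac_profile G (frac_mix G l X Y) S = l * frac_profile G X S + (1 - l) * frac_profile G Y S"
proof -
  let ?C = "\<lambda>q p b1 c1 b2 c2. frac_class G (p * b1 * b2)
    (coloring_sum (coloring_mult (q * b2) c1) (coloring_mult ((p - q) * b1) c2))"
  let ?h = "\<lambda>S. l * frac_profile G X S + (1 - l) * frac_profile G Y S"
  have C: "?C q p b1 c1 b2 c2 \<in> frac_colorings G \<and>
      (\<forall>S. frac_profile G (?C q p b1 c1 b2 c2) S = ?h S)"
    if h: "0 < p" "q \<le> p" "l = of_nat q / of_nat p" "(b1, c1) \<in> X" "(b2, c2) \<in> Y"
    for q p b1 c1 b2 c2
  proof -
    let ?c = "coloring_sum (coloring_mult (q * b2) c1) (coloring_mult ((p - q) * b1) c2)"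
    have b: "0 < b1" "0 < b2" and c: "fold_coloring G b1 c1" "fold_coloring G b2 c2"
      using frac_coloringsD[OF X h(4)] frac_coloringsD[OF Y h(5)] by auto
    note m = fold_coloring_mult[OF c(1), of "q * b2"] fold_coloring_mult[OF c(2), of "(p - q) * b1"]
    \<comment> \<open>\<open>r\<close> stands for \<open>p - q\<close> and keeps truncated
      subtraction out of the computations.\<close>
    obtain r where r: "p = q + r" using h(2) le_Suc_ex by blast
    have "q * b2 * b1 + (p - q) * b1 * b2 = p * b1 * b2"
      unfolding r by (simp add: algebra_simps)
    then have f: "fold_coloring G (p * b1 * b2) ?c"
      using fold_coloring_sum[OF m] by simp
    have pos: "0 < p * b1 * b2" using h(1) b by simp
    note C = frac_class_in_frac_colorings[OF pos f]
    have cnt: "color_count G ?c S = q * b2 * color_count G c1 S + r * b1 * color_count G c2 S" for S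
      using color_count_sum[OF finite_colors_used[OF m(1)] finite_colors_used[OF m(2)]]
      by (simp add: color_count_mult[OF c(1)] color_count_mult[OF c(2)] r)
    have "rat_of_nat r = of_nat p - of_nat q" by (simp add: r)
    then have ml: "1 - l = of_nat r / of_nat p"
      using h(1) by (simp add: h(3) diff_divide_distrib)
    have "frac_profile G (?C q p b1 c1 b2 c2) S = ?h S" for S
      using h(1) b unfolding frac_profile_eq[OF C] frac_profile_eq[OF X h(4)]
        frac_profile_eq[OF Y h(5)] cnt ml unfolding h(3)
      by (simp add: field_simps)
    then show ?thesis using C by blast
  qed
  obtain b1 c1 where 1: "(b1, c1) \<in> X" using X by (rule frac_colorings_cases)
  obtain b2 c2 where 2: "(b2, c2) \<in> Y" using Y by (rule frac_colorings_cases)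
  \<comment> \<open>The reduced fraction of \<open>l\<close> shows that at least one choice exists,
    so that the union is not empty.\<close>
  obtain a d where ad: "quotient_of l = (a, d)" by fastforce
  have d: "0 < d" and la: "l = of_int a / of_int d"
    using quotient_of_denom_pos[OF ad] quotient_of_div[OF ad] by auto
  have a: "0 \<le> a" "a \<le> d" using l d unfolding la by (auto simp: field_simps zero_le_divide_iff)
  define q p where "q = nat a" and "p = nat d"
  have qp: "0 < p" "q \<le> p" "l = of_nat q / of_nat p"
    using a d la by (auto simp: q_def p_def)
  note C0 = C[OF qp 1 2]
  have "frac_mix G l X Y = ?C q p b1 c1 b2 c2"
  proof -
    let ?F = "{?C q p b1 c1 b2 c2 | q p b1 c1 b2 c2. 0 < p \<and> q \<le> p \<and>
      l = of_nat q / of_nat p \<and> (b1, c1) \<in> X \<and> (b2, c2) \<in> Y}"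
    have "Z = ?C q p b1 c1 b2 c2" if "Z \<in> ?F" for Z
    proof -
      have "Z \<in> frac_colorings G \<and> (\<forall>S. frac_profile G Z S = ?h S)" using that C by blast
      then show ?thesis using C0 by (intro frac_profile_eqI) auto
    qed
    moreover have "?C q p b1 c1 b2 c2 \<in> ?F" using qp 1 2 by blast
    ultimately have "?F = {?C q p b1 c1 b2 c2}" by blast
    then show ?thesis unfolding frac_mix_def by simp
  qed
  then show "frac_mix G l X Y \<in> frac_colorings G"
    "frac_profile G (frac_mix G l X Y) S = ?h S"
    using C0 by auto
qed

text \<open>After clearing denominators, \<open>N S\<close> fresh colors are created for each
  \<open>S\<close> and given to exactly the vertices of \<open>S\<close>. Each vertex gets
  \<open>b\<close> colors by the sum condition, and adjacent vertices share none because the support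
  consists of independent sets.\<close>

lemma feasible_profile_realized:
  assumes x: "feasible_profile G x"
  obtains X where "X \<in> frac_colorings G" "\<And>S. frac_profile G X S = x S"
proof -
  have nonneg: "0 \<le> x S" for S using x by (simp add: feasible_profile_def)
  have supp: "S \<noteq> {}" "S \<subseteq> verts G" "u \<in> S \<Longrightarrow> v \<in> S \<Longrightarrow> \<not> u \<rightarrow>\<^bsub>G\<^esub> v" if "x S \<noteq> 0" for S u v
    using x that by (auto simp: feasible_profile_def)
  have sum1: "(\<Sum>S | S \<subseteq> verts G \<and> v \<in> S. x S) = 1" if "v \<in> verts G" for v
    using x that by (simp add: feasible_profile_def)
  let ?I = "Pow (verts G)"
  have finI: "finite ?I" using fin by simp
  obtain b N where b: "0 < b" and N: "\<And>S. S \<in> ?I \<Longrightarrow> x S = of_nat (N S) / of_nat b"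
    by (rule common_denominator[OF finI, of x]) (use nonneg in auto)
  obtain e :: "'a set \<Rightarrow> nat" where e: "inj_on e ?I"
    using finite_imp_inj_to_nat_seg[OF finI] by auto
  \<comment> \<open>The number \<open>e S\<close> of the set \<open>S\<close> is part of each color,
    which makes the blocks \<open>B S\<close> disjoint.\<close>
  define B where "B S = (\<lambda>i. prod_encode (e S, i)) ` {..<N S}" for S
  define c where "c v = (\<Union>S\<in>{S. S \<subseteq> verts G \<and> v \<in> S}. B S)" for v
  have finB: "finite (B S)" and cardB: "card (B S) = N S" for S
    by (auto simp: B_def card_image inj_on_def)
  have disj: "S = S'" if "y \<in> B S" "y \<in> B S'" "S \<in> ?I" "S' \<in> ?I" for y S S'
    using that e by (auto simp: B_def dest: inj_onD)
  have mem: "y \<in> c v \<longleftrightarrow> v \<in> S" if "y \<in> B S" "S \<in> ?I" for y S v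
    using disj that unfolding c_def by blast
  \<comment> \<open>A nonempty block belongs to the support of \<open>x\<close>, so its set is
    independent.\<close>
  have B_ne: "x S \<noteq> 0" if "y \<in> B S" "S \<in> ?I" for y S
    using that N[of S] b by (auto simp: B_def)
  have cardc: "card (c v) = b" if v: "v \<in> verts G" for v
  proof -
    have "card (c v) = (\<Sum>S | S \<subseteq> verts G \<and> v \<in> S. N S)"
      unfolding c_def using fin finB disj
      by (subst card_UN_disjoint) (auto simp: cardB)
    then have "rat_of_nat (card (c v)) / of_nat b = (\<Sum>S | S \<subseteq> verts G \<and> v \<in> S. x S)"
      using N by (simp add: sum_divide_distrib)
    then show ?thesis using sum1[OF v] b by simp
  qed
  have f: "fold_coloring G b c"
    unfolding fold_coloring_def
  proof (intro conjI ballI allI impI)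
    fix v assume "v \<in> verts G"
    then show "card (c v) = b" by (rule cardc)
    show "finite (c v)" using fin finB by (auto simp: c_def)
  next
    fix u v assume uv: "u \<rightarrow>\<^bsub>G\<^esub> v"
    show "c u \<inter> c v = {}"
    proof (rule ccontr)
      assume "c u \<inter> c v \<noteq> {}"
      then obtain y S where y: "y \<in> B S" "S \<in> ?I" "u \<in> S" "y \<in> c v" unfolding c_def by auto
      then show False using mem[OF y(1,2)] B_ne[OF y(1,2)] supp(3) uv by blast
    qed
  qed
  have cnt: "of_nat (color_count G c S) / of_nat b = x S" for S
  \<comment> \<open>A color of \<open>B S\<close> counts as used only through some vertex of
    \<open>S\<close>, so the empty set is treated with the sets outside \<open>?I\<close>, where
    both sides are 0.\<close>
  proof (cases "S \<in> ?I \<and> S \<noteq> {}")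
    case True
    have "{y \<in> colors_used G c. {v \<in> verts G. y \<in> c v} = S} = B S"
    proof (rule Set.set_eqI)
      fix y
      show "y \<in> {y \<in> colors_used G c. {v \<in> verts G. y \<in> c v} = S} \<longleftrightarrow> y \<in> B S"
      proof
        assume y: "y \<in> {y \<in> colors_used G c. {v \<in> verts G. y \<in> c v} = S}"
        then obtain S' where S': "y \<in> B S'" "S' \<in> ?I"
          by (auto simp: colors_used_def c_def)
        then have "{v \<in> verts G. y \<in> c v} = S'" using mem[OF S'] by auto
        then show "y \<in> B S" using y S' by simp
      next
        assume y: "y \<in> B S"
        then show "y \<in> {y \<in> colors_used G c. {v \<in> verts G. y \<in> c v} = S}"
          using mem[OF y] True by (auto simp: colors_used_def)
      qed
    qed
    then show ?thesis using True N[of S] by (simp add: color_count_def cardB)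
  next
    case False
    then have "x S = 0" using supp(1,2)[of S] by blast
    moreover have "color_count G c S = 0"
      using False color_count_eq_0[of S G c] by (cases "S = {}") auto
    ultimately show ?thesis by simp
  qed
  note X = frac_class_in_frac_colorings[OF b f]
  show thesis
    by (rule that[OF X(1)]) (simp add: frac_profile_eq[OF X] cnt)
qed

section \<open>Extremal fractional colorings\<close>

lemma slack_profile_mix:
  assumes "X \<in> frac_colorings G" "Y \<in> frac_colorings G" "0 \<le> l" "l \<le> 1"
  shows "slack_profile G \<tau> (frac_mix G l X Y) S =
    l * slack_profile G \<tau> X S + (1 - l) * slack_profile G \<tau> Y S"
proof -
  have "frac_weight G (frac_mix G l X Y) = l * frac_weight G X + (1 - l) * frac_weight G Y"
    unfolding frac_weight_eq[OF assms(1)] frac_weight_eq[OF assms(2)]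
      frac_weight_eq[OF frac_mix_profile(1)[OF assms]] frac_mix_profile(2)[OF assms]
    by (simp add: sum.distrib sum_distrib_left)
  then show ?thesis
    by (simp add: slack_profile_def frac_mix_profile(2)[OF assms] algebra_simps)
qed

text \<open>The coordinates of a profile are nonnegative anyway, and the one at \<open>{}\<close>
  encodes the weight bound. All inequalities are now signs of coordinates, so faces can be tracked
  by supports.\<close>

lemma frac_colorings_le_iff:
  "X \<in> frac_colorings_le G \<tau> \<longleftrightarrow> X \<in> frac_colorings G \<and> (\<forall>S. 0 \<le> slack_profile G \<tau> X S)"
proof -
  have "(\<forall>S. 0 \<le> slack_profile G \<tau> X S) \<longleftrightarrow> frac_weight G X \<le> \<tau>" if "X \<in> frac_colorings G"
  proof -
    have "0 \<le> frac_profile G X S" for S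
      using feasible_frac_profile[OF that] by (simp add: feasible_profile_def)
    then show ?thesis by (auto simp: slack_profile_def)
  qed
  then show ?thesis by (auto simp: frac_colorings_le_def)
qed

lemma frac_convex_le: "frac_convex G (frac_colorings_le G \<tau>)"
  unfolding frac_convex_def
proof (intro conjI ballI allI impI)
  show "frac_colorings_le G \<tau> \<subseteq> frac_colorings G" by (auto simp: frac_colorings_le_def)
next
  fix X Y and l :: rat
  assume "X \<in> frac_colorings_le G \<tau>" "Y \<in> frac_colorings_le G \<tau>" "0 \<le> l \<and> l \<le> 1"
  then show "frac_mix G l X Y \<in> frac_colorings_le G \<tau>"
    by (simp add: frac_colorings_le_iff frac_mix_profile(1) slack_profile_mix)
qed

text \<open>Nonnegative numbers combined with positive weights give 0 only if all of them are 0. The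
  weights need not sum to 1, since the tails in the recursion of \<open>frac_comb\<close> do not.
  Membership in \<open>T\<close> is proved along with this, to have nonnegativity for the
  combination of the tail.\<close>

lemma frac_comb_slack_profile_0:
  assumes T: "frac_convex G T" "\<And>Y. Y \<in> T \<Longrightarrow> 0 \<le> slack_profile G \<tau> Y S"
    and "ws \<noteq> []" "snd ` set ws \<subseteq> T" "\<forall>w\<in>fst ` set ws. 0 < w"
  shows "frac_comb G ws \<in> T \<and>
    (slack_profile G \<tau> (frac_comb G ws) S = 0 \<longrightarrow>
      (\<forall>Y\<in>snd ` set ws. slack_profile G \<tau> Y S = 0))"
  using assms(3-5)
proof (induction ws rule: induct_list012)
  case 1
  then show ?case by simp
next
  case (2 wX)
  then show ?case by (cases wX) auto
next
  case (3 wX y ys)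
  obtain w X where wX: "wX = (w, X)" by fastforce
  let ?Z = "frac_comb G (y # ys)"
  define s where "s = sum_list (map fst (y # ys))"
  define l where "l = w / (w + s)"
  have Z: "?Z \<in> T" "slack_profile G \<tau> ?Z S = 0 \<Longrightarrow>
      \<forall>Y\<in>snd ` set (y # ys). slack_profile G \<tau> Y S = 0"
    using "3.IH"(2) "3.prems" by auto
  have X: "X \<in> T" and w: "0 < w" using "3.prems" wX by auto
  have "\<forall>w\<in>set (map fst ys). 0 \<le> w" using "3.prems"(3) by auto
  then have "0 \<le> sum_list (map fst ys)" by (intro sum_list_nonneg) blast
  moreover have "0 < fst y" using "3.prems"(3) by simp
  ultimately have "0 < s" by (simp add: s_def)
  \<comment> \<open>Both factors \<open>l\<close> and \<open>1 - l\<close> are strictly positive, so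
    a vanishing mix forces both of its terms to vanish.\<close>
  then have l: "0 < l" "l < 1" using w by (auto simp: l_def)
  have comb: "frac_comb G (wX # y # ys) = frac_mix G l X ?Z"
    by (simp add: wX l_def s_def)
  have sub: "T \<subseteq> frac_colorings G" using T(1) by (simp add: frac_convex_def)
  have "frac_mix G l X ?Z \<in> T" using T(1) X Z(1) l by (simp add: frac_convex_def)
  moreover have "slack_profile G \<tau> (frac_mix G l X ?Z) S =
      l * slack_profile G \<tau> X S + (1 - l) * slack_profile G \<tau> ?Z S"
    using X Z(1) sub l by (intro slack_profile_mix) auto
  moreover have "0 \<le> l * slack_profile G \<tau> X S" "0 \<le> (1 - l) * slack_profile G \<tau> ?Z S"
    using T(2)[OF X] T(2)[OF Z(1)] l by auto
  ultimately show ?case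
    unfolding comb using Z(2) l by (auto simp: wX add_nonneg_eq_0_iff)
qed

text \<open>The first two entries of a combination that violates extremality serve as
  \<open>Y\<close> and \<open>Z\<close>; by \<open>frac_comb_slack_profile_0\<close> they vanish
  wherever \<open>X\<close> does.\<close>

lemma not_extremalE:
  assumes X: "X \<in> frac_colorings_le G \<tau>" and "\<not> frac_extremal G (frac_colorings_le G \<tau>) X"
  obtains Y Z where "Y \<in> frac_colorings_le G \<tau>" "Z \<in> frac_colorings_le G \<tau>" "Y \<noteq> Z"
    "\<forall>S. slack_profile G \<tau> X S = 0 \<longrightarrow> slack_profile G \<tau> Y S = 0 \<and> slack_profile G \<tau> Z S = 0"
proof -
  let ?T = "frac_colorings_le G \<tau>"
  obtain ws where ws: "2 \<le> length ws" "distinct (map snd ws)" "snd ` set ws \<subseteq> ?T"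
    "\<forall>w\<in>fst ` set ws. 0 < w" "X = frac_comb G ws"
    using assms by (auto simp: frac_extremal_def)
  obtain y z zs where yz: "ws = y # z # zs"
    using ws(1) by (auto simp: numeral_2_eq_2 Suc_le_length_iff)
  show thesis
  proof (rule that)
    show "snd y \<in> ?T" "snd z \<in> ?T" "snd y \<noteq> snd z" using ws(2,3) by (auto simp: yz)
    show "\<forall>S. slack_profile G \<tau> X S = 0 \<longrightarrow>
      slack_profile G \<tau> (snd y) S = 0 \<and> slack_profile G \<tau> (snd z) S = 0"
    proof (intro allI impI)
      fix S
      assume 0: "slack_profile G \<tau> X S = 0"
      have "0 \<le> slack_profile G \<tau> Y S" if "Y \<in> ?T" for Y
        using that by (simp add: frac_colorings_le_iff)
      moreover have "ws \<noteq> []" by (simp add: yz)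
      ultimately have "\<forall>Y\<in>snd ` set ws. slack_profile G \<tau> Y S = 0"
        using frac_comb_slack_profile_0[OF frac_convex_le, of \<tau> \<tau> S ws] ws(3,4) 0
        unfolding ws(5) by blast
      then show "slack_profile G \<tau> (snd y) S = 0 \<and> slack_profile G \<tau> (snd z) S = 0"
        by (simp add: yz)
    qed
  qed
qed

text \<open>Moving \<open>X\<close> along \<open>Y - Z\<close> preserves the vertex equations, since
  \<open>Y\<close> and \<open>Z\<close> both satisfy them, and keeps zero coordinates at zero. The
  ratio test gives the step at which a further coordinate becomes zero while none is
  negative.\<close>

lemma move_along_difference:
  assumes X: "X \<in> frac_colorings_le G \<tau>" and Y: "Y \<in> frac_colorings_le G \<tau>"
    and Z: "Z \<in> frac_colorings_le G \<tau>" and ne: "Y \<noteq> Z"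
    and "\<forall>S. slack_profile G \<tau> X S = 0 \<longrightarrow>
      slack_profile G \<tau> Y S = 0 \<and> slack_profile G \<tau> Z S = 0"
  obtains t X' where "0 < t" "X' \<in> frac_colorings_le G \<tau>"
    "\<forall>S. frac_profile G X' S = frac_profile G X S + t * (frac_profile G Y S - frac_profile G Z S)"
    "{S \<in> Pow (verts G). slack_profile G \<tau> X' S \<noteq> 0} \<subset>
     {S \<in> Pow (verts G). slack_profile G \<tau> X S \<noteq> 0}"
proof -
  let ?p = "frac_profile G" and ?s = "slack_profile G \<tau>"
  have supp: "?s Y S = 0 \<and> ?s Z S = 0" if "?s X S = 0" for S
    using assms(5) that by blast
  \<comment> \<open>The direction includes the slack coordinate, so the move also stops when the
    weight bound becomes tight.\<close>
  define d where "d S = ?s Y S - ?s Z S" for S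
  have FC: "X \<in> frac_colorings G" "Y \<in> frac_colorings G" "Z \<in> frac_colorings G"
    using X Y Z by (auto simp: frac_colorings_le_iff)
  note F = feasible_frac_profile[OF FC(1)] feasible_frac_profile[OF FC(2)]
    feasible_frac_profile[OF FC(3)]
  obtain S0 where S0: "?p Y S0 \<noteq> ?p Z S0" using frac_profile_eqI[OF FC(2,3)] ne by blast
  then have "S0 \<noteq> {} \<and> S0 \<subseteq> verts G" using feasible_profile_support F(2,3) by metis
  then obtain v where "S0 \<subseteq> verts G" and v: "v \<in> verts G" "v \<in> S0" by blast
  \<comment> \<open>The ratio test needs a decreasing coordinate. Over the sets containing
    \<open>v\<close> both profiles sum to 1, so a difference at \<open>S0\<close> forces
    \<open>Y\<close> below \<open>Z\<close> somewhere.\<close>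
  have "\<exists>S. S \<subseteq> verts G \<and> v \<in> S \<and> ?p Y S < ?p Z S"
  proof (rule ccontr)
    assume "\<not> ?thesis"
    then have le: "?p Z S \<le> ?p Y S" if "S \<in> {S. S \<subseteq> verts G \<and> v \<in> S}" for S
      using that not_less by blast
    have "(\<Sum>S | S \<subseteq> verts G \<and> v \<in> S. ?p Z S) < (\<Sum>S | S \<subseteq> verts G \<and> v \<in> S. ?p Y S)"
    proof (rule sum_strict_mono_ex1)
      show "finite {S. S \<subseteq> verts G \<and> v \<in> S}" using fin by simp
      show "\<forall>S\<in>{S. S \<subseteq> verts G \<and> v \<in> S}. ?p Z S \<le> ?p Y S" using le by blast
      have "S0 \<in> {S. S \<subseteq> verts G \<and> v \<in> S}" using \<open>S0 \<subseteq> verts G\<close> v(2) by blast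
      moreover from this have "?p Z S0 < ?p Y S0" using le S0 by (metis order_le_less)
      ultimately show "\<exists>S\<in>{S. S \<subseteq> verts G \<and> v \<in> S}. ?p Z S < ?p Y S" by blast
    qed
    then show False using F(2,3) v(1) by (simp add: feasible_profile_def)
  qed
  then obtain S1 where "S1 \<subseteq> verts G" "v \<in> S1" "?p Y S1 < ?p Z S1" by blast
  \<comment> \<open>Containing \<open>v\<close>, the set \<open>S1\<close> is nonempty, so its
    coordinate is a profile value and not the slack.\<close>
  then have S1: "S1 \<in> Pow (verts G)" "d S1 < 0"
    by (auto simp: d_def slack_profile_def)
  have finV: "finite (Pow (verts G))" using fin by simp
  have s0: "\<forall>S\<in>Pow (verts G). 0 \<le> ?s X S" using X by (simp add: frac_colorings_le_iff)
  have d0: "\<forall>S\<in>Pow (verts G). ?s X S = 0 \<longrightarrow> d S = 0" using supp by (simp add: d_def)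
  obtain t S2 where t: "0 < t" "\<forall>S\<in>Pow (verts G). 0 \<le> ?s X S + t * d S"
    "S2 \<in> Pow (verts G)" "?s X S2 \<noteq> 0" "?s X S2 + t * d S2 = 0"
    using ratio_test[OF finV s0 d0 S1] .
  \<comment> \<open>This is the moved point in profile coordinates, with 0 instead of the slack at
    \<open>{}\<close>. It is shown feasible and then realized by a class.\<close>
  define x where "x S = ?p X S + t * (?p Y S - ?p Z S)" for S
  have x_s: "x S = ?s X S + t * d S" if "S \<noteq> {}" for S
    using that by (simp add: x_def d_def slack_profile_def)
  have zero: "x S = 0" if "?p X S = 0" for S
  proof (cases "S = {}")
    case True
    then show ?thesis using F[THEN feasible_profile_empty] by (simp add: x_def)
  next
    case False
    then show ?thesis using supp[of S] that by (simp add: x_def slack_profile_def)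
  qed
  have x0: "0 \<le> x S" for S
  proof (cases "?p X S = 0")
    case False
    then have "S \<noteq> {}" "S \<in> Pow (verts G)" using feasible_profile_support[OF F(1)] by auto
    then show ?thesis using t(2) x_s by simp
  qed (simp add: zero)
  have "(\<Sum>S | S \<subseteq> verts G \<and> v \<in> S. x S) = 1" if v: "v \<in> verts G" for v
  proof -
    have sum1: "(\<Sum>S | S \<subseteq> verts G \<and> v \<in> S. y S) = 1" if "feasible_profile G y" for y
      using that v by (simp add: feasible_profile_def)
    show ?thesis
      unfolding x_def sum.distrib sum_distrib_left[symmetric] sum_subtractf F[THEN sum1] by simp
  qed
  moreover have "S \<noteq> {} \<and> S \<subseteq> verts G \<and> (\<forall>u\<in>S. \<forall>v\<in>S. \<not> u \<rightarrow>\<^bsub>G\<^esub> v)" if "x S \<noteq> 0" for S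
    using F(1) zero[of S] that unfolding feasible_profile_def by blast
  ultimately have "feasible_profile G x"
    unfolding feasible_profile_def using x0 by blast
  then obtain X' where X': "X' \<in> frac_colorings G" "\<And>S. ?p X' S = x S"
    using feasible_profile_realized by metis
  \<comment> \<open>The weight is linear in the profile, so the slack moves by
    \<open>t * d {}\<close>, in step with the other coordinates.\<close>
  have w: "frac_weight G X' =
      frac_weight G X + t * (frac_weight G Y - frac_weight G Z)"
    unfolding frac_weight_eq[OF X'(1)] FC[THEN frac_weight_eq] X'(2) x_def
    by (simp add: sum.distrib sum_subtractf flip: sum_distrib_left)
  have s': "?s X' S = ?s X S + t * d S" for S
    using X'(2) by (simp add: slack_profile_def d_def w x_def algebra_simps)
  have "0 \<le> ?s X' S" for S
  proof (cases "S \<in> Pow (verts G)")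
    case True
    then show ?thesis unfolding s' by (rule bspec[OF t(2)])
  next
    case False
    then have "?s X' S = x S" using X'(2) by (auto simp: slack_profile_def)
    then show ?thesis using x0 by simp
  qed
  then have T': "X' \<in> frac_colorings_le G \<tau>" using X'(1) by (simp add: frac_colorings_le_iff)
  have "?s X' S = 0" if "?s X S = 0" for S using supp[OF that] that by (simp add: s' d_def)
  moreover have "?s X' S2 = 0" using t(5) s' by simp
  ultimately have "{S \<in> Pow (verts G). ?s X' S \<noteq> 0} \<subset> {S \<in> Pow (verts G). ?s X S \<noteq> 0}"
    using t(3,4) by blast
  then show thesis using that[OF t(1) T'] X'(2) by (simp add: x_def)
qed

text \<open>Induction on the number of nonzero slack coordinates: a class that is not extremal is a
  mix of two classes with smaller support. \<open>C\<close> is an arbitrary convex set because the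
  hull is the intersection of all such sets.\<close>

lemma frac_colorings_le_subset:
  assumes C: "frac_convex G C" "{X. frac_extremal G (frac_colorings_le G \<tau>) X} \<subseteq> C"
  shows "frac_colorings_le G \<tau> \<subseteq> C"
proof
  fix X
  assume "X \<in> frac_colorings_le G \<tau>"
  then show "X \<in> C"
  proof (induction "card {S \<in> Pow (verts G). slack_profile G \<tau> X S \<noteq> 0}"
      arbitrary: X rule: less_induct)
    case less
    have fin': "finite {S \<in> Pow (verts G). slack_profile G \<tau> X S \<noteq> 0}" using fin by simp
    show ?case
    proof (cases "frac_extremal G (frac_colorings_le G \<tau>) X")
      case True
      then show ?thesis using C(2) by blast
    next
      case False
      obtain Y Z where YZ: "Y \<in> frac_colorings_le G \<tau>" "Z \<in> frac_colorings_le G \<tau>" "Y \<noteq> Z"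
        "\<forall>S. slack_profile G \<tau> X S = 0 \<longrightarrow>
          slack_profile G \<tau> Y S = 0 \<and> slack_profile G \<tau> Z S = 0"
        using not_extremalE[OF less.prems False] .
      obtain t1 X1 where 1: "0 < t1" "X1 \<in> frac_colorings_le G \<tau>"
        "\<forall>S. frac_profile G X1 S =
          frac_profile G X S + t1 * (frac_profile G Y S - frac_profile G Z S)"
        "{S \<in> Pow (verts G). slack_profile G \<tau> X1 S \<noteq> 0} \<subset>
         {S \<in> Pow (verts G). slack_profile G \<tau> X S \<noteq> 0}"
        using move_along_difference[OF less.prems YZ] .
      have YZ': "\<forall>S. slack_profile G \<tau> X S = 0 \<longrightarrow>
          slack_profile G \<tau> Z S = 0 \<and> slack_profile G \<tau> Y S = 0"
        using YZ(4) by blast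
      \<comment> \<open>Exchanging \<open>Y\<close> and \<open>Z\<close> gives the move in the
        opposite direction.\<close>
      obtain t2 X2 where 2: "0 < t2" "X2 \<in> frac_colorings_le G \<tau>"
        "\<forall>S. frac_profile G X2 S =
          frac_profile G X S + t2 * (frac_profile G Z S - frac_profile G Y S)"
        "{S \<in> Pow (verts G). slack_profile G \<tau> X2 S \<noteq> 0} \<subset>
         {S \<in> Pow (verts G). slack_profile G \<tau> X S \<noteq> 0}"
        using move_along_difference[OF less.prems YZ(2,1) YZ(3)[symmetric] YZ'] .
      have X12: "X1 \<in> C" "X2 \<in> C"
        using less.hyps[OF psubset_card_mono[OF fin' 1(4)] 1(2)]
          less.hyps[OF psubset_card_mono[OF fin' 2(4)] 2(2)] by auto
      \<comment> \<open>With this weight \<open>l * t1 = (1 - l) * t2\<close>, so the two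
        displacements cancel.\<close>
      define l where "l = t2 / (t1 + t2)"
      have l: "0 \<le> l" "l \<le> 1" using 1(1) 2(1) by (auto simp: l_def)
      have FC: "X \<in> frac_colorings G" "X1 \<in> frac_colorings G" "X2 \<in> frac_colorings G"
        using less.prems 1(2) 2(2) by (auto simp: frac_colorings_le_iff)
      have "l * t1 = (1 - l) * t2" using 1(1) 2(1) by (simp add: l_def field_simps)
      moreover have "l * (p + t1 * (y - z)) + (1 - l) * (p + t2 * (z - y)) =
          p + (l * t1 - (1 - l) * t2) * (y - z)" for p y z
        by (simp add: algebra_simps)
      ultimately have "X = frac_mix G l X1 X2"
        using FC l by (intro frac_profile_eqI) (auto simp: frac_mix_profile 1(3) 2(3))
      then show ?thesis using C(1) X12 l by (simp add: frac_convex_def)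
    qed
  qed
qed

text \<open>One inclusion is \<open>frac_colorings_le_subset\<close> for every convex set that
  contains the extremal classes; the other holds because the left side is itself such a set. If no
  class has weight at most \<tau>, both sides are empty.\<close>

lemma frac_colorings_le_eq_hull:
  "frac_colorings_le G \<tau> = frac_convex G hull {X. frac_extremal G (frac_colorings_le G \<tau>) X}"
proof
  show "frac_colorings_le G \<tau> \<subseteq>
      frac_convex G hull {X. frac_extremal G (frac_colorings_le G \<tau>) X}"
    unfolding hull_def using frac_colorings_le_subset by (intro Inter_greatest) auto
  show "frac_convex G hull {X. frac_extremal G (frac_colorings_le G \<tau>) X} \<subseteq>
      frac_colorings_le G \<tau>"
    by (rule hull_minimal) (auto simp: frac_extremal_def frac_convex_le)
qed

section \<open>The embedding into rational vectors\<close>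

lemma frac_profile_vec_embedding:
  assumes n: "card (verts G) = n"
  shows "\<exists>\<phi> :: 'a frac_coloring \<Rightarrow> rat vec.
    \<phi> \<in> frac_colorings G \<rightarrow> carrier_vec (2 ^ n - 1) \<and>
    inj_on \<phi> (frac_colorings G) \<and>
    (\<forall>X\<in>frac_colorings G. \<forall>Y\<in>frac_colorings G. \<forall>l. 0 \<le> l \<and> l \<le> 1 \<longrightarrow>
       \<phi> (frac_mix G l X Y) = l \<cdot>\<^sub>v \<phi> X + (1 - l) \<cdot>\<^sub>v \<phi> Y)"
proof -
  \<comment> \<open>The vector coordinates are the nonempty vertex sets, enumerated by
    \<open>e\<close>.\<close>
  have "card (Pow (verts G) - {{}}) = 2 ^ n - 1" using fin n by (simp add: card_Pow)
  moreover have "finite (Pow (verts G) - {{}})" using fin by simp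
  ultimately obtain e where e: "bij_betw e {0..<2 ^ n - 1 :: nat} (Pow (verts G) - {{}})"
    using ex_bij_betw_nat_finite by metis
  define \<phi> where "\<phi> X = vec (2 ^ n - 1) (\<lambda>i. frac_profile G X (e i))" for X
  have "inj_on \<phi> (frac_colorings G)"
  proof (rule inj_onI)
    fix X Y
    assume XY: "X \<in> frac_colorings G" "Y \<in> frac_colorings G" "\<phi> X = \<phi> Y"
    have "frac_profile G X S = frac_profile G Y S" for S
    proof (cases "S \<in> Pow (verts G) - {{}}")
      case True
      then have "S \<in> e ` {0..<2 ^ n - 1}" unfolding bij_betw_imp_surj_on[OF e] .
      then obtain i where "S = e i" "i \<in> {0..<2 ^ n - 1}" by (rule imageE)
      then have i: "i < 2 ^ n - 1" "e i = S" by auto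
      have "\<phi> X $ i = \<phi> Y $ i" using XY(3) by simp
      then show ?thesis using i by (simp add: \<phi>_def)
    next
      \<comment> \<open>Profiles vanish at the sets without a coordinate, so the vector loses no
        information.\<close>
      case False
      then have "frac_profile G X S = 0" "frac_profile G Y S = 0"
        using feasible_profile_support[OF feasible_frac_profile[OF XY(1)], of S]
          feasible_profile_support[OF feasible_frac_profile[OF XY(2)], of S] by blast+
      then show ?thesis by simp
    qed
    then show "X = Y" by (rule frac_profile_eqI[OF XY(1,2)])
  qed
  moreover have "\<phi> (frac_mix G l X Y) = l \<cdot>\<^sub>v \<phi> X + (1 - l) \<cdot>\<^sub>v \<phi> Y"
    if "X \<in> frac_colorings G" "Y \<in> frac_colorings G" "0 \<le> l" "l \<le> 1" for X Y l
    using frac_mix_profile(2)[OF that] by (intro eq_vecI) (auto simp: \<phi>_def)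
  ultimately show ?thesis by (intro exI[of _ \<phi>]) (auto simp: \<phi>_def)
qed

end

theorem theorem2:
  fixes G :: "('a, 'b) pre_digraph" and n :: nat
  assumes "graph G" and "card (verts G) = n"
  shows "(\<exists>\<phi> :: 'a frac_coloring \<Rightarrow> rat vec.
            \<phi> \<in> frac_colorings G \<rightarrow> carrier_vec (2 ^ n - 1) \<and>
            inj_on \<phi> (frac_colorings G) \<and>
            (\<forall>X\<in>frac_colorings G. \<forall>Y\<in>frac_colorings G. \<forall>l. 0 \<le> l \<and> l \<le> 1 \<longrightarrow>
               \<phi> (frac_mix G l X Y) = l \<cdot>\<^sub>v \<phi> X + (1 - l) \<cdot>\<^sub>v \<phi> Y)) \<and>
         (\<forall>\<tau> :: rat. \<exists>E \<subseteq> {X. frac_extremal G (frac_colorings_le G \<tau>) X}.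
            frac_colorings_le G \<tau> = (frac_convex G) hull E)"
proof -
  interpret graph G by (rule assms(1))
  have fin: "finite (verts G)" by simp
  \<comment> \<open>The set of all extremal classes serves as \<open>E\<close>.\<close>
  show ?thesis
    using frac_profile_vec_embedding[OF fin assms(2)] frac_colorings_le_eq_hull[OF fin] by blast
qed

end
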